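(* Let $0<\mu<L$, let $f\in\mathcal{F}_{\mu,L}$ with minimum value $f_*$ and minimizer $x_*$, let $x_0\in\mathbb{R}^n$ and $N\in\mathbb{N}$. Consider the iteration $$x_{k+1}=x_k-\gamma_k\nabla f(x_k),\qquad \gamma_k=2\,\frac{f(x_k)-f_*}{\|\nabla f(x_k)\|^2},\qquad k\ge 0.$$ If the step sizes $\gamma_0,\dots,\gamma_{N-1}$ are well defined (i.e. no denominator vanishes), then $$\|x_N-x_*\|^2\le\left(\prod_{k=0}^{N-1}\rho(\gamma_k)\right)\|x_0-x_*\|^2,\qquad\text{where } \rho(\gamma)=\frac{(\gamma L-1)(1-\gamma\mu)}{\gamma(L+\mu)-1},$$ and $$\max_{\gamma\in[\frac1L,\frac1\mu]}\rho(\gamma)=\frac{(L-\mu)^2}{(L+\mu)^2}.$$ Otherwise (if the step sizes are not all well defined), $\nabla f(x_k)=0$ for some $k\in\{0,\dots,N\}$.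
   Context: $\|\cdot\|$ is the Euclidean norm on $\mathbb{R}^n$. $\mathcal{F}_{\mu,L}$ denotes the class of differentiable functions $f:\mathbb{R}^n\to\mathbb{R}$ that are $L$-smooth and $\mu$-strongly convex, i.e. for all $x,y\in\mathbb{R}^n$: $f(y)\le f(x)+\langle\nabla f(x),y-x\rangle+\frac L2\|y-x\|^2$ and $f(y)\ge f(x)+\langle\nabla f(x),y-x\rangle+\frac\mu2\|y-x\|^2$. *)

theory Defs
  imports "HOL-Analysis.Analysis"
begin

definition gradient :: "('a::real_inner \<Rightarrow> real) \<Rightarrow> 'a \<Rightarrow> 'a" where
  "gradient f x = (THE D. GDERIV f x :> D)"

lemma gradient_eq:
  assumes "GDERIV f x :> D"
  shows "gradient f x = D"
  unfolding gradient_def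
proof (rule the_equality)
  fix E assume "GDERIV f x :> E"
  with assms have "(\<lambda>h. inner h E) = (\<lambda>h. inner h D)"
    unfolding gderiv_def by (blast intro: has_derivative_unique)
  then have "inner (E - D) (E - D) = 0"
    by (metis cancel_comm_monoid_add_class.diff_cancel inner_diff_right)
  then show "E = D" by simp
qed (fact assms)

lemma gderiv_gradient:
  fixes f :: "'a::euclidean_space \<Rightarrow> real"
  assumes "f differentiable (at x)"
  shows "GDERIV f x :> gradient f x"
proof -
  from assms obtain f' where f': "(f has_derivative f') (at x)"
    by (auto simp: differentiable_def)
  then have lin: "linear f'" by (rule has_derivative_linear)
  have "f' = (\<lambda>h. inner h (adjoint f' 1))"
    using adjoint_works[OF lin, of _ 1] by (auto simp: fun_eq_iff)
  with f' have "GDERIV f x :> adjoint f' 1" by (simp add: gderiv_def)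
  then show ?thesis using gradient_eq by metis
qed

definition smooth_strongly_convex :: "real \<Rightarrow> real \<Rightarrow> ('a::euclidean_space \<Rightarrow> real) set" where
  "smooth_strongly_convex \<mu> L = {f.
     (\<forall>x. f differentiable (at x)) \<and>
     (\<forall>x y. f y \<le> f x + gradient f x \<bullet> (y - x) + L / 2 * (norm (y - x))\<^sup>2) \<and>
     (\<forall>x y. f y \<ge> f x + gradient f x \<bullet> (y - x) + \<mu> / 2 * (norm (y - x))\<^sup>2)}"

text \<open>The step size is meaningful only where the gradient does not vanish; elsewhere the
  total division of HOL makes it 0.\<close>

definition polyak_step :: "('a::real_inner \<Rightarrow> real) \<Rightarrow> real \<Rightarrow> 'a \<Rightarrow> real" where
  "polyak_step f fstar x = 2 * ((f x - fstar) / (norm (gradient f x))\<^sup>2)"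

definition polyak_rate :: "real \<Rightarrow> real \<Rightarrow> real \<Rightarrow> real" where
  "polyak_rate \<mu> L \<gamma> = (\<gamma> * L - 1) * (1 - \<gamma> * \<mu>) / (\<gamma> * (L + \<mu>) - 1)"

end

theory Submission
  imports Defs
begin

text \<open>Write $g = \nabla f(x)$ and $d = x - x_*$. Up to positive factors, the interpolation inequalities of
  $\mathcal{F}_{\mu,L}$ for $(x, x_*)$ and $(x_*, x)$ are linear in $\|d\|^2$, $g \cdot d$ and
  $\|g\|^2$ once $f(x) - f_* = \gamma \|g\|^2 / 2$ is substituted. Adding them with the weights
  $(\gamma L - 1)/(L - \mu)$ and $(1 - \gamma\mu)/(L - \mu)$, which are nonnegative because
  $1/L \le \gamma \le 1/\mu$, gives $\|x - \gamma g - x_*\|^2 \le \rho(\gamma) \|d\|^2$.\<close>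

section \<open>Inequalities of the function class and the range of the step size\<close>

lemma smooth_strongly_convexD:
  assumes "f \<in> smooth_strongly_convex \<mu> L"
  shows "f y \<le> f x + gradient f x \<bullet> (y - x) + L / 2 * (norm (y - x))\<^sup>2"
    and "f x + gradient f x \<bullet> (y - x) + \<mu> / 2 * (norm (y - x))\<^sup>2 \<le> f y"
  using assms by (auto simp: smooth_strongly_convex_def)

text \<open>At every point \<open>z\<close>, the quadratic lower model at \<open>x\<close> lies
  below \<open>f z\<close>, and \<open>f z\<close> lies below the quadratic upper model at
  \<open>y\<close>. Comparing the two models at the best \<open>z\<close> leaves an inequality in
  the data at \<open>x\<close> and \<open>y\<close> alone.\<close>

lemma smooth_strongly_convex_interpolation:
  fixes x y :: "'a::euclidean_space"
  assumes "\<mu> < L" and f: "f \<in> smooth_strongly_convex \<mu> L"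
  shows "f x + gradient f x \<bullet> (y - x)
       + ((norm (gradient f x - gradient f y))\<^sup>2 + \<mu> * L * (norm (x - y))\<^sup>2
          - 2 * \<mu> * ((gradient f x - gradient f y) \<bullet> (x - y))) / (2 * (L - \<mu>)) \<le> f y"
proof -
  define d where "d = x - y"
  define q where "q = gradient f y"
  define r where "r = gradient f x - q"
  define v where "v = r - \<mu> *\<^sub>R d"
  define t where "t = 1 / (L - \<mu>)"
  have gx: "gradient f x = r + q" by (simp add: r_def)
  have t: "t * (L - \<mu>) = 1" using assms(1) by (simp add: t_def)
  \<comment> \<open>This point maximises the gap between the lower model at \<open>x\<close> and the upper model at \<open>y\<close>.\<close>
  define z where "z = y + t *\<^sub>R v"
  have zx: "z - x = t *\<^sub>R v - d" and zy: "z - y = t *\<^sub>R v" and yx: "y - x = - d"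
    by (simp_all add: z_def d_def)
  have "f x + (r + q) \<bullet> (t *\<^sub>R v - d) + \<mu> / 2 * (norm (t *\<^sub>R v - d))\<^sup>2
      \<le> f y + q \<bullet> (t *\<^sub>R v) + L / 2 * (norm (t *\<^sub>R v))\<^sup>2"
    using smooth_strongly_convexD(2)[OF f, of x z] smooth_strongly_convexD(1)[OF f, of z y]
    unfolding zx zy gx q_def[symmetric] by linarith
  \<comment> \<open>The factor \<open>t * (L - \<mu>)\<close> is kept intact to be rewritten to 1,
    and \<open>r - \<mu> *\<^sub>R d\<close> is \<open>v\<close>: a linear gain of
    \<open>t * (v \<bullet> v)\<close> against a quadratic loss of half that size.\<close>
  then have "f x - (r + q) \<bullet> d + \<mu> / 2 * (d \<bullet> d) + t * (v \<bullet> (r - \<mu> *\<^sub>R d))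
      - (t * (L - \<mu>)) * t / 2 * (v \<bullet> v) \<le> f y"
    unfolding power2_norm_eq_inner
    by (simp add: inner_simps inner_commute power2_eq_square diff_divide_distrib algebra_simps)
  then have "f x - (r + q) \<bullet> d + \<mu> / 2 * (d \<bullet> d) + t / 2 * (v \<bullet> v) \<le> f y"
    unfolding t v_def[symmetric] by simp
  moreover have "\<mu> / 2 * (d \<bullet> d) + t / 2 * (v \<bullet> v)
      = (r \<bullet> r + \<mu> * L * (d \<bullet> d) - 2 * \<mu> * (r \<bullet> d)) / (2 * (L - \<mu>))"
    using assms(1) unfolding v_def t_def
    by (simp add: inner_simps inner_commute field_simps)
  ultimately show ?thesis
    by (simp add: gx yx power2_norm_eq_inner flip: q_def d_def)
qed

text \<open>A gradient step of length \<open>1 / L\<close> lowers \<open>f\<close> by at least the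
  squared gradient norm over \<open>2 * L\<close>, yet cannot go below \<open>m\<close>. This yields
  \<open>1 / L\<close> \<le> \<gamma>.\<close>

lemma smooth_strongly_convex_gap_ge:
  fixes x :: "'a::euclidean_space"
  assumes "0 < L" and f: "f \<in> smooth_strongly_convex \<mu> L" and low: "\<And>y. m \<le> f y"
  shows "(norm (gradient f x))\<^sup>2 \<le> 2 * L * (f x - m)"
proof -
  have "m \<le> f (x - (1 / L) *\<^sub>R gradient f x)" by (fact low)
  also have "\<dots> \<le> f x - (norm (gradient f x))\<^sup>2 / (2 * L)"
  proof -
    have "L / 2 * (norm ((1 / L) *\<^sub>R gradient f x))\<^sup>2 = (norm (gradient f x))\<^sup>2 / (2 * L)"
      using assms(1) by (simp add: power_divide) (simp add: power2_eq_square)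
    then show ?thesis
      using smooth_strongly_convexD(1)[OF f, of "x - (1 / L) *\<^sub>R gradient f x" x] assms(1)
      by (simp add: power2_norm_eq_inner)
  qed
  finally show ?thesis using assms(1) by (simp add: field_simps)
qed

text \<open>The Polyak-Lojasiewicz inequality, by completing the square in the lower model at
  \<open>x\<close>. With \<open>y\<close> a minimizer it yields \<gamma> \<le>
  \<open>1 / \<mu>\<close>.\<close>

lemma smooth_strongly_convex_gap_le:
  fixes x y :: "'a::euclidean_space"
  assumes "0 < \<mu>" and f: "f \<in> smooth_strongly_convex \<mu> L"
  shows "2 * \<mu> * (f x - f y) \<le> (norm (gradient f x))\<^sup>2"
proof -
  let ?g = "gradient f x" and ?h = "y - x"
  have "0 \<le> (norm (?g + \<mu> *\<^sub>R ?h))\<^sup>2" by simp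
  also have "\<dots> = (norm ?g)\<^sup>2 + 2 * \<mu> * (?g \<bullet> ?h + \<mu> / 2 * (norm ?h)\<^sup>2)"
    by (simp only: power2_norm_eq_inner inner_simps) (simp add: inner_commute algebra_simps)
  also have "\<dots> \<le> (norm ?g)\<^sup>2 + 2 * \<mu> * (f y - f x)"
    using smooth_strongly_convexD(2)[OF f, of x y] assms(1) by simp
  finally show ?thesis by (simp add: algebra_simps)
qed

lemma gradient_minimizer_eq_0:
  fixes xstar :: "'a::euclidean_space"
  assumes "0 < L" and "f \<in> smooth_strongly_convex \<mu> L" and "\<And>y. f xstar \<le> f y"
  shows "gradient f xstar = 0"
  using smooth_strongly_convex_gap_ge[OF assms, of xstar] by simp

lemma polyak_step_bounds:
  fixes x xstar :: "'a::euclidean_space"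
  assumes "0 < \<mu>" and "\<mu> < L" and f: "f \<in> smooth_strongly_convex \<mu> L"
    and min: "\<And>y. f xstar \<le> f y" and g: "gradient f x \<noteq> 0"
  shows "polyak_step f (f xstar) x \<in> {1 / L..1 / \<mu>}"
  using smooth_strongly_convex_gap_ge[OF _ f min, of x] smooth_strongly_convex_gap_le[OF assms(1) f, of x xstar]
    assms(1,2) g
  by (simp add: polyak_step_def field_simps)

section \<open>The rate and its maximum\<close>

lemma polyak_rate_denominator_pos:
  fixes \<mu> L \<gamma> :: real
  assumes "0 < \<mu>" and "\<mu> < L" and "\<gamma> \<in> {1 / L..1 / \<mu>}"
  shows "0 < \<gamma> * (L + \<mu>) - 1"
proof -
  have "0 < \<gamma>" using assms by (auto intro: less_le_trans[of 0 "1 / L"])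
  then have "0 < \<gamma> * \<mu>" using assms(1) by simp
  moreover have "1 \<le> \<gamma> * L" using assms by (simp add: field_simps)
  ultimately show ?thesis unfolding distrib_left by linarith
qed

lemma polyak_rate_nonneg:
  assumes "0 < \<mu>" and "\<mu> < L" and "\<gamma> \<in> {1 / L..1 / \<mu>}"
  shows "0 \<le> polyak_rate \<mu> L \<gamma>"
proof -
  have "0 \<le> \<gamma> * L - 1" and "0 \<le> 1 - \<gamma> * \<mu>" using assms by (simp_all add: field_simps)
  then show ?thesis
    using polyak_rate_denominator_pos[OF assms] by (simp add: polyak_rate_def)
qed

text \<open>This form, with a monomial as numerator, serves both the maximization of the rate and
  the contraction estimate.\<close>

lemma one_minus_polyak_rate:
  assumes "\<gamma> * (L + \<mu>) - 1 \<noteq> 0"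
  shows "1 - polyak_rate \<mu> L \<gamma> = \<gamma>\<^sup>2 * L * \<mu> / (\<gamma> * (L + \<mu>) - 1)"
proof -
  have "1 - polyak_rate \<mu> L \<gamma>
      = ((\<gamma> * (L + \<mu>) - 1) - (\<gamma> * L - 1) * (1 - \<gamma> * \<mu>)) / (\<gamma> * (L + \<mu>) - 1)"
    using assms by (simp add: polyak_rate_def diff_divide_distrib)
  also have "(\<gamma> * (L + \<mu>) - 1) - (\<gamma> * L - 1) * (1 - \<gamma> * \<mu>) = \<gamma>\<^sup>2 * L * \<mu>"
    by (simp add: power2_eq_square algebra_simps)
  finally show ?thesis .
qed

text \<open>With \<open>D = \<gamma> * (L + \<mu>) - 1\<close>, the bound
  \<open>4 * D \<le> (D + 1)\<^sup>2\<close> keeps \<open>1 - polyak_rate \<mu> L \<gamma>\<close>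
  from being too small. Equality holds at \<open>D = 1\<close>, that is, at
  \<open>\<gamma> = 2 / (L + \<mu>)\<close>.\<close>

lemma polyak_rate_le:
  assumes "0 < \<mu>" and "\<mu> < L" and "\<gamma> \<in> {1 / L..1 / \<mu>}"
  shows "polyak_rate \<mu> L \<gamma> \<le> (L - \<mu>)\<^sup>2 / (L + \<mu>)\<^sup>2"
proof -
  let ?D = "\<gamma> * (L + \<mu>) - 1"
  have D: "0 < ?D" by (rule polyak_rate_denominator_pos[OF assms])
  have "0 \<le> (\<gamma> * (L + \<mu>) - 2)\<^sup>2" by simp
  then have "4 * ?D \<le> \<gamma>\<^sup>2 * (L + \<mu>)\<^sup>2" by (simp add: power2_eq_square algebra_simps)
  then have "L * \<mu> * (4 * ?D) \<le> L * \<mu> * (\<gamma>\<^sup>2 * (L + \<mu>)\<^sup>2)"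
    using assms by (intro mult_left_mono) auto
  then have "4 * L * \<mu> * ?D \<le> \<gamma>\<^sup>2 * L * \<mu> * (L + \<mu>)\<^sup>2" by (simp only: mult_ac)
  then have "4 * L * \<mu> / (L + \<mu>)\<^sup>2 \<le> \<gamma>\<^sup>2 * L * \<mu> / ?D"
    using D assms by (subst frac_le_eq) (auto simp: divide_nonpos_pos)
  also have "\<dots> = 1 - polyak_rate \<mu> L \<gamma>" using D by (simp add: one_minus_polyak_rate)
  finally have "polyak_rate \<mu> L \<gamma> \<le> 1 - 4 * L * \<mu> / (L + \<mu>)\<^sup>2" by simp
  also have "\<dots> = (L - \<mu>)\<^sup>2 / (L + \<mu>)\<^sup>2"
    using assms by (simp add: divide_simps) (simp add: power2_eq_square algebra_simps)
  finally show ?thesis .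
qed

lemma polyak_rate_optimum:
  assumes "0 < \<mu>" and "\<mu> < L"
  shows "2 / (L + \<mu>) \<in> {1 / L..1 / \<mu>}"
    and "polyak_rate \<mu> L (2 / (L + \<mu>)) = (L - \<mu>)\<^sup>2 / (L + \<mu>)\<^sup>2"
  using assms by (auto simp: polyak_rate_def field_simps power2_eq_square)

section \<open>Contraction in one step and its iteration\<close>

lemma polyak_step_contraction:
  fixes x xstar :: "'a::euclidean_space"
  assumes "0 < \<mu>" and "\<mu> < L" and f: "f \<in> smooth_strongly_convex \<mu> L"
    and min: "\<And>y. f xstar \<le> f y" and g: "gradient f x \<noteq> 0"
  shows "(norm (x - polyak_step f (f xstar) x *\<^sub>R gradient f x - xstar))\<^sup>2
       \<le> polyak_rate \<mu> L (polyak_step f (f xstar) x) * (norm (x - xstar))\<^sup>2"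
proof -
  define \<gamma> where "\<gamma> = polyak_step f (f xstar) x"
  define d where "d = x - xstar"
  define a where "a = d \<bullet> d"
  define b where "b = gradient f x \<bullet> d"
  define c where "c = gradient f x \<bullet> gradient f x"
  define D where "D = \<gamma> * (L + \<mu>) - 1"
  have \<gamma>: "\<gamma> \<in> {1 / L..1 / \<mu>}"
    unfolding \<gamma>_def by (rule polyak_step_bounds[OF assms])
  have D: "0 < D"
    unfolding D_def by (rule polyak_rate_denominator_pos[OF assms(1,2) \<gamma>])
  have "0 < \<gamma>" using \<gamma> assms(1,2) by (auto intro: less_le_trans[of 0 "1 / L"])
  have g0: "gradient f xstar = 0"
    by (rule gradient_minimizer_eq_0[OF _ f min]) (use assms(1,2) in simp)
  \<comment> \<open>The definition of the step size solved for the gap, so that function values can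
    be eliminated below.\<close>
  have gap: "f x - f xstar = \<gamma> * c / 2"
    using g by (simp add: \<gamma>_def c_def polyak_step_def power2_norm_eq_inner)
  have "f x - f xstar - b + (c + \<mu> * L * a - 2 * \<mu> * b) / (2 * (L - \<mu>)) \<le> 0"
    using smooth_strongly_convex_interpolation[OF assms(2) f, of x xstar]
    by (simp add: g0 a_def b_def c_def d_def power2_norm_eq_inner inner_diff_right)
  then have A: "((L - \<mu>) * \<gamma> + 1) * c - 2 * L * b + \<mu> * L * a \<le> 0"
    unfolding gap using assms(2) by (simp add: field_simps)
  have "f xstar - f x + (c + \<mu> * L * a - 2 * \<mu> * b) / (2 * (L - \<mu>)) \<le> 0"
    using smooth_strongly_convex_interpolation[OF assms(2) f, of xstar x]
    by (simp add: g0 a_def b_def c_def d_def power2_norm_eq_inner inner_diff_right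
        inner_diff_left inner_commute algebra_simps)
  then have "- (\<gamma> * c / 2) + (c + \<mu> * L * a - 2 * \<mu> * b) / (2 * (L - \<mu>)) \<le> 0"
    using gap by linarith
  then have B: "(1 - (L - \<mu>) * \<gamma>) * c - 2 * \<mu> * b + \<mu> * L * a \<le> 0"
    using assms(2) by (simp add: field_simps)
  have wA: "0 \<le> \<gamma> * L - 1" and wB: "0 \<le> 1 - \<gamma> * \<mu>"
    using \<gamma> assms(1,2) by (simp_all add: field_simps)
  \<comment> \<open>With these weights every coefficient of the sum has the factor
    \<open>L - \<mu>\<close>, and those of \<open>b\<close> and \<open>c\<close> stand in the ratio
    -2 to \<gamma>, as in the expansion of the squared norm of
    \<open>d - \<gamma> *\<^sub>R gradient f x\<close>.\<close>
  have "(L - \<mu>) * (\<gamma> * L * \<mu> * a - 2 * D * b + \<gamma> * D * c)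
      = (\<gamma> * L - 1) * (((L - \<mu>) * \<gamma> + 1) * c - 2 * L * b + \<mu> * L * a)
      + (1 - \<gamma> * \<mu>) * ((1 - (L - \<mu>) * \<gamma>) * c - 2 * \<mu> * b + \<mu> * L * a)"
    by (simp add: D_def algebra_simps)
  also have "\<dots> \<le> 0"
    by (intro add_nonpos_nonpos mult_nonneg_nonpos wA wB A B)
  finally have "\<gamma> * L * \<mu> * a - 2 * D * b + \<gamma> * D * c \<le> 0"
    using assms(2) by (simp add: mult_le_0_iff)
  \<comment> \<open>The scaling by \<open>\<gamma> / D\<close> makes the terms in \<open>b\<close>
    and \<open>c\<close> exactly those of that expansion; the coefficient of \<open>a\<close>
    becomes 1 minus the rate.\<close>
  then have "\<gamma> / D * (\<gamma> * L * \<mu> * a - 2 * D * b + \<gamma> * D * c) \<le> 0"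
    using \<open>0 < \<gamma>\<close> D by (intro mult_nonneg_nonpos) auto
  then have "\<gamma>\<^sup>2 * L * \<mu> / D * a - 2 * \<gamma> * b + \<gamma>\<^sup>2 * c \<le> 0"
    using D by (simp add: field_simps power2_eq_square)
  then have "(1 - polyak_rate \<mu> L \<gamma>) * a - 2 * \<gamma> * b + \<gamma>\<^sup>2 * c \<le> 0"
    using D one_minus_polyak_rate[of \<gamma> L \<mu>] by (simp add: D_def)
  then have "a - 2 * \<gamma> * b + \<gamma>\<^sup>2 * c \<le> polyak_rate \<mu> L \<gamma> * a"
    by (simp add: algebra_simps)
  moreover have "x - \<gamma> *\<^sub>R gradient f x - xstar = d - \<gamma> *\<^sub>R gradient f x"
    by (simp add: d_def)
  moreover have "(norm (d - \<gamma> *\<^sub>R gradient f x))\<^sup>2 = a - 2 * \<gamma> * b + \<gamma>\<^sup>2 * c"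
    unfolding power2_norm_eq_inner a_def b_def c_def
    by (simp add: inner_simps inner_commute power2_eq_square algebra_simps)
  ultimately show ?thesis
    unfolding \<gamma>_def[symmetric] by (simp only: a_def d_def power2_norm_eq_inner)
qed

theorem proposition1:
  fixes f :: "real ^ 'n \<Rightarrow> real"
    and xstar x0 :: "real ^ 'n"
    and x :: "nat \<Rightarrow> real ^ 'n"
    and \<mu> L fstar :: real
    and N :: nat
  assumes "0 < \<mu>" and "\<mu> < L"
    and "f \<in> smooth_strongly_convex \<mu> L"
    and "f xstar = fstar" and "\<And>y. fstar \<le> f y"
    and "x 0 = x0"
    and "\<And>k. (norm (gradient f (x k)))\<^sup>2 \<noteq> 0 \<Longrightarrow>
           x (Suc k) = x k - polyak_step f fstar (x k) *\<^sub>R gradient f (x k)"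
  shows "((\<forall>k<N. (norm (gradient f (x k)))\<^sup>2 \<noteq> 0) \<longrightarrow>
            (norm (x N - xstar))\<^sup>2
              \<le> (\<Prod>k<N. polyak_rate \<mu> L (polyak_step f fstar (x k))) * (norm (x0 - xstar))\<^sup>2)
       \<and> ((\<exists>\<gamma>\<in>{1 / L..1 / \<mu>}. polyak_rate \<mu> L \<gamma> = (L - \<mu>)\<^sup>2 / (L + \<mu>)\<^sup>2) \<and>
          (\<forall>\<gamma>\<in>{1 / L..1 / \<mu>}. polyak_rate \<mu> L \<gamma> \<le> (L - \<mu>)\<^sup>2 / (L + \<mu>)\<^sup>2))
       \<and> (\<not> (\<forall>k<N. (norm (gradient f (x k)))\<^sup>2 \<noteq> 0) \<longrightarrow>
            (\<exists>k\<in>{0..N}. gradient f (x k) = 0))"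
proof (intro conjI impI)
  note fstar = \<open>f xstar = fstar\<close>
  have min: "f xstar \<le> f y" for y using assms(5) by (simp add: fstar)
  show "(norm (x N - xstar))\<^sup>2
      \<le> (\<Prod>k<N. polyak_rate \<mu> L (polyak_step f fstar (x k))) * (norm (x0 - xstar))\<^sup>2"
    if "\<forall>k<N. (norm (gradient f (x k)))\<^sup>2 \<noteq> 0"
    using that
  proof (induction N)
    case 0
    then show ?case by (simp add: assms(6))
  next
    case (Suc n)
    let ?\<rho> = "polyak_rate \<mu> L (polyak_step f fstar (x n))"
    have g: "gradient f (x n) \<noteq> 0" using Suc.prems by auto
    have "(norm (x (Suc n) - xstar))\<^sup>2 \<le> ?\<rho> * (norm (x n - xstar))\<^sup>2"
      using polyak_step_contraction[OF assms(1-3) min g] assms(7)[of n] g by (simp add: fstar)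
    also have "\<dots> \<le> ?\<rho> * ((\<Prod>k<n. polyak_rate \<mu> L (polyak_step f fstar (x k)))
        * (norm (x0 - xstar))\<^sup>2)"
      \<comment> \<open>Multiplying the induction hypothesis by \<open>?\<rho>\<close> preserves its
        direction because the step size lies where the rate is nonnegative.\<close>
      using Suc polyak_rate_nonneg[OF assms(1,2) polyak_step_bounds[OF assms(1-3) min g]]
      by (intro mult_left_mono) (auto simp: fstar)
    finally show ?case by (simp add: mult_ac)
  qed
  show "\<exists>\<gamma>\<in>{1 / L..1 / \<mu>}. polyak_rate \<mu> L \<gamma> = (L - \<mu>)\<^sup>2 / (L + \<mu>)\<^sup>2"
    using polyak_rate_optimum[OF assms(1,2)] by blast
  show "\<forall>\<gamma>\<in>{1 / L..1 / \<mu>}. polyak_rate \<mu> L \<gamma> \<le> (L - \<mu>)\<^sup>2 / (L + \<mu>)\<^sup>2"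
    using polyak_rate_le[OF assms(1,2)] by blast
  show "\<exists>k\<in>{0..N}. gradient f (x k) = 0" if "\<not> (\<forall>k<N. (norm (gradient f (x k)))\<^sup>2 \<noteq> 0)"
    using that by fastforce
qed

end
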